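(* Fix $a\in\mathbb{Z}$, let $\delta=a^2-4$, and define $(u_n)_{n\geq 0}$ by $u_0=0$, $u_1=1$, $u_{n+2}=au_{n+1}-u_n$. Let $\ell\geq 3$ be a prime with $\ell\nmid\delta$. Let $n_0\in\mathbb{Z}_{>0}$ satisfy $$u_{n_0}\neq 0\quad\text{and}\quad r_0:=v_\ell(u_{n_0})\geq 1.$$ Define $N_j:=n_0\ell^j$ for $j\in\mathbb{Z}_{\geq 0}$. Fix an odd integer $t$. Then, for every $M\in\mathbb{Z}_{>0}$, every residue class $c\pmod{\ell^M}$, and every integer $j\geq\max\{0,M-r_0\}$, the set $$\left\{k\in\mathbb{Z}_{>0}\colon 2\nmid k,\ k\equiv t\pmod{u_{N_j}^2},\ \frac{u_{N_jk}/u_{N_j}-t}{u_{N_j}^2}\equiv c\pmod{\ell^M}\right\}$$ is infinite.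
   Context: $v_\ell$ denotes the usual $\ell$-adic valuation on $\mathbb{Q}$. All congruences are between integers (in particular, the last congruence asserts that the quotient on its left-hand side is an integer). *)

theory Defs
  imports "HOL-Number_Theory.Number_Theory"
begin

fun lucas_u :: "int \<Rightarrow> nat \<Rightarrow> int" where
  "lucas_u a 0 = 0"
| "lucas_u a (Suc 0) = 1"
| "lucas_u a (Suc (Suc n)) = a * lucas_u a (Suc n) - lucas_u a n"

text \<open>
  A congruence for a rational number: it includes the assertion that the
  number is an integer.
\<close>

definition rat_cong :: "rat \<Rightarrow> int \<Rightarrow> int \<Rightarrow> bool" where
  "rat_cong x c m \<longleftrightarrow> (\<exists>q. x = of_int q \<and> [q = c] (mod m))"

end

theory Submission
  imports Defs
begin

text \<open>
  Put \<open>n = N j\<close>, \<open>U = u n\<close> and let \<open>v = 2 * u (n + 1) - a * u n\<close> be the companion value, so that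
  \<open>u (n * k) / u n\<close> is the \<open>k\<close>-th Lucas number with parameter \<open>v\<close>, and \<open>v\<^sup>2 - 4 = \<delta> * U\<^sup>2\<close>.
  For odd \<open>k = 2 * m + 1\<close> this number is a polynomial in \<open>z = \<delta> * U\<^sup>2\<close> starting with
  \<open>k + (\<Sum>i\<le>m. i\<^sup>2) * z\<close>, where the sum of squares equals \<open>(k\<^sup>3 - k) / 24\<close>.
  Since \<open>l ^ M\<close> divides \<open>U\<close>, for \<open>k = t + s * U\<^sup>2\<close> the quotient in question is congruent to \<open>s\<close>
  plus a constant modulo \<open>l ^ M\<close>, and \<open>s\<close> can be prescribed modulo \<open>2 * l ^ M\<close>.
\<close>

section \<open>Lucas identities and multiples of the index\<close>

text \<open>This is the usual \<open>u (m+1) * u n - u m * u (n-1)\<close>, with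
  \<open>u (n-1)\<close> replaced by \<open>a * u n - u (n+1)\<close> to avoid an index
  subtraction.\<close>

lemma lucas_u_add:
  "lucas_u a (m + n) = lucas_u a (Suc m) * lucas_u a n + lucas_u a m * lucas_u a (Suc n)
     - a * lucas_u a m * lucas_u a n"
proof (induction m rule: induct_nat_012)
  case (ge2 m)
  have "lucas_u a (Suc (Suc m) + n) = a * lucas_u a (Suc m + n) - lucas_u a (m + n)"
    by simp
  also have "\<dots> = lucas_u a (Suc (Suc (Suc m))) * lucas_u a n
      + lucas_u a (Suc (Suc m)) * lucas_u a (Suc n) - a * lucas_u a (Suc (Suc m)) * lucas_u a n"
    unfolding ge2 by (simp add: algebra_simps)
  finally show ?case .
qed simp_all

text \<open>The form \<open>X^2 - a*X*Y + Y^2\<close> is preserved by one step of the recurrence,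
  whose matrix has determinant 1.\<close>

lemma lucas_u_invariant:
  "(lucas_u a (Suc n))\<^sup>2 - a * lucas_u a n * lucas_u a (Suc n) + (lucas_u a n)\<^sup>2 = 1"
  by (induction n) (simp_all add: algebra_simps power2_eq_square)

text \<open>The power sum of the roots of \<open>X^2 - a*X + 1\<close>, usually written
  \<open>u (n+1) - u (n-1)\<close>.\<close>

definition lucas_v :: "int \<Rightarrow> nat \<Rightarrow> int" where
  "lucas_v a n = 2 * lucas_u a (Suc n) - a * lucas_u a n"

lemma lucas_v_square: "(lucas_v a n)\<^sup>2 - 4 = (a\<^sup>2 - 4) * (lucas_u a n)\<^sup>2"
proof -
  have "(lucas_v a n)\<^sup>2 - 4 = (a\<^sup>2 - 4) * (lucas_u a n)\<^sup>2 + 4 * ((lucas_u a (Suc n))\<^sup>2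
     - a * lucas_u a n * lucas_u a (Suc n) + (lucas_u a n)\<^sup>2 - 1)"
    unfolding lucas_v_def by (simp add: power2_eq_square algebra_simps)
  then show ?thesis
    using lucas_u_invariant[of a n] by simp
qed

text \<open>Along steps of length \<open>n\<close> the sequence again obeys a recurrence of the same
  type, now with parameter \<open>lucas_v a n\<close>.\<close>

lemma lucas_u_add_twice:
  "lucas_u a (m + (n + n)) = lucas_v a n * lucas_u a (m + n) - lucas_u a m"
proof -
  define p p' q q' where "p = lucas_u a m" and "p' = lucas_u a (Suc m)"
    and "q = lucas_u a n" and "q' = lucas_u a (Suc n)"
  have mn: "lucas_u a (m + n) = p' * q + p * q' - a * p * q"
    unfolding p_def p'_def q_def q'_def by (rule lucas_u_add)
  have mn': "lucas_u a (Suc (m + n)) = p' * q' - p * q"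
    using lucas_u_add[of a "Suc m" n] unfolding p_def p'_def q_def q'_def
    by (simp add: algebra_simps)
  have inv: "q'\<^sup>2 - a * q * q' + q\<^sup>2 = 1"
    unfolding q_def q'_def by (rule lucas_u_invariant)
  have "lucas_u a (m + (n + n)) = lucas_u a (Suc (m + n)) * q + lucas_u a (m + n) * q'
      - a * lucas_u a (m + n) * q"
    using lucas_u_add[of a "m + n" n] unfolding q_def q'_def by (simp add: add.assoc)
  \<comment> \<open>The last summand is arranged as \<open>p\<close> times the invariant form, so
    that it collapses to \<open>p\<close>.\<close>
  also have "\<dots> = (2 * q' - a * q) * (p' * q + p * q' - a * p * q)
      - p * (q'\<^sup>2 - a * q * q' + q\<^sup>2)"
    unfolding mn mn' by (simp add: algebra_simps power2_eq_square)
  finally show ?thesis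
    unfolding inv mn lucas_v_def by (simp add: p_def q_def q'_def)
qed

text \<open>As functions of \<open>k\<close>, both sides satisfy the same second-order recurrence
  and agree at 0 and 1.\<close>

lemma lucas_u_mult: "lucas_u a (n * k) = lucas_u a n * lucas_u (lucas_v a n) k"
proof (induction k rule: induct_nat_012)
  case (ge2 k)
  have "n * Suc (Suc k) = n * k + (n + n)" "n * Suc k = n * k + n"
    by simp_all
  then show ?case
    using ge2 lucas_u_add_twice[of a "n * k" n] by (simp only: lucas_u.simps) (simp add: right_diff_distrib mult.left_commute)
qed simp_all

section \<open>Expansion of odd-indexed terms\<close>

text \<open>Odd-indexed terms satisfy a recurrence with parameter \<open>v^2 - 2 = z + 2\<close>.
  Comparing linear coefficients in \<open>z\<close>, their second difference is the constant term
  \<open>2*m + 3\<close>, which is \<open>(m+2)^2 - (m+1)^2\<close>; hence sums of squares.\<close>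

lemma lucas_u_odd_expansion:
  "\<exists>b. lucas_u v (2 * m + 1) = 2 * int m + 1 + (v\<^sup>2 - 4) * (\<Sum>i\<le>m. (int i)\<^sup>2) + (v\<^sup>2 - 4)\<^sup>2 * b"
proof (induction m rule: induct_nat_012)
  case 0
  show ?case by (rule exI[of _ 0]) simp
next
  case 1
  show ?case by (rule exI[of _ 0]) (simp add: numeral_eq_Suc)
next
  case (ge2 m)
  define z where "z = v\<^sup>2 - 4"
  define S where "S = (\<Sum>i\<le>m. (int i)\<^sup>2)"
  obtain b where b: "lucas_u v (2 * m + 1) = 2 * int m + 1 + z * S + z\<^sup>2 * b"
    using ge2(1) unfolding z_def S_def by blast
  have S: "(\<Sum>i\<le>Suc m. (int i)\<^sup>2) = S + (int m + 1)\<^sup>2"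
    "(\<Sum>i\<le>Suc (Suc m). (int i)\<^sup>2) = S + (int m + 1)\<^sup>2 + (int m + 2)\<^sup>2"
    by (simp_all add: S_def add.commute)
  obtain b' where b': "lucas_u v (2 * Suc m + 1)
      = 2 * int (Suc m) + 1 + z * (S + (int m + 1)\<^sup>2) + z\<^sup>2 * b'"
    using ge2(2) unfolding z_def S by blast
  have "lucas_u v (2 * Suc (Suc m) + 1) = (v\<^sup>2 - 2) * lucas_u v (2 * Suc m + 1) - lucas_u v (2 * m + 1)"
    by (simp add: algebra_simps power2_eq_square)
  also have "\<dots> = (z + 2) * lucas_u v (2 * Suc m + 1) - lucas_u v (2 * m + 1)"
    by (simp add: z_def)
  also have "\<dots> = 2 * int (Suc (Suc m)) + 1 + z * (S + (int m + 1)\<^sup>2 + (int m + 2)\<^sup>2)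
      + z\<^sup>2 * (S + (int m + 1)\<^sup>2 + (z + 2) * b' - b)"
    unfolding b b' by (simp add: algebra_simps power2_eq_square)
  finally show ?case
    unfolding S z_def[symmetric] by (rule exI)
qed

lemma sum_squares_24: "24 * (\<Sum>i\<le>m. (int i)\<^sup>2) = (2 * int m + 1) ^ 3 - (2 * int m + 1)"
  by (induction m) (simp_all add: algebra_simps power2_eq_square power3_eq_cube)

section \<open>Powers of the prime\<close>

text \<open>Since 24 = 2^3 * 3 and \<open>p\<close> is odd, at most one factor is lost, namely when
  \<open>p = 3\<close>.\<close>

lemma prime_power_dvd_of_dvd_24_mult:
  fixes p :: nat and x :: int
  assumes p: "prime p" "p \<ge> 3" and dvd: "int p ^ Suc e dvd 24 * x"
  shows "int p ^ e dvd x"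
proof -
  have "coprime (int p ^ Suc e) 2"
    using p primes_coprime_nat[of p 2] by (simp add: two_is_prime_nat flip: coprime_int_iff)
  then have "coprime (int p ^ Suc e) (2 ^ 3)"
    by (metis coprime_power_right_iff)
  then have dvd3: "int p ^ Suc e dvd 3 * x"
    using dvd coprime_dvd_mult_right_iff[of "int p ^ Suc e" "2 ^ 3" "3 * x"] by simp
  show ?thesis
  proof (cases "p = 3")
    case True
    then show ?thesis using dvd3 by simp
  next
    case False
    have "prime (3::nat)" by simp
    then have "coprime (int p ^ Suc e) 3"
      using p False primes_coprime_nat[of p 3] by (simp flip: coprime_int_iff)
    then have "int p ^ Suc e dvd x"
      using dvd3 coprime_dvd_mult_right_iff by blast
    then show ?thesis
      using power_le_dvd[of "int p" "Suc e" x e] by simp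
  qed
qed

text \<open>The cofactor \<open>lucas_u v p\<close> has the form \<open>p * (1 + p*e)\<close>,
  because \<open>p^2\<close> divides \<open>z\<close>. It supplies the extra factor
  \<open>p\<close>, and it is nonzero because \<open>1 + p*e\<close> is 1 modulo
  \<open>p\<close>.\<close>

lemma lucas_u_prime_step:
  fixes p :: nat
  assumes p: "prime p" "p \<ge> 3" and nz: "lucas_u a n \<noteq> 0" and dvd: "int p ^ Suc r dvd lucas_u a n"
  shows "lucas_u a (n * p) \<noteq> 0" and "int p ^ Suc (Suc r) dvd lucas_u a (n * p)"
proof -
  define v where "v = lucas_v a n"
  have "odd p"
    using p prime_odd_nat by auto
  then obtain m where m: "p = 2 * m + 1"
    by (elim oddE)
  define z where "z = v\<^sup>2 - 4"
  have "int p dvd lucas_u a n"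
    using dvd by (metis dvd_trans dvd_power zero_less_Suc)
  then have z: "(int p)\<^sup>2 dvd z"
    unfolding z_def v_def lucas_v_square by (intro dvd_mult dvd_power_same)
  obtain b where "lucas_u v (2 * m + 1)
      = 2 * int m + 1 + z * (\<Sum>i\<le>m. (int i)\<^sup>2) + z\<^sup>2 * b"
    unfolding z_def using lucas_u_odd_expansion by blast
  then have "lucas_u v p = int p + z * ((\<Sum>i\<le>m. (int i)\<^sup>2) + z * b)"
    unfolding m by (simp add: algebra_simps power2_eq_square)
  moreover obtain d where "z = (int p)\<^sup>2 * d"
    using z by blast
  ultimately have "lucas_u v p = int p * (1 + int p * (d * ((\<Sum>i\<le>m. (int i)\<^sup>2) + z * b)))"
    by (simp add: distrib_left power2_eq_square mult.assoc)
  then obtain e where e: "lucas_u v p = int p * (1 + int p * e)"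
    by blast
  have "\<not> int p dvd 1"
    using p by simp
  then have "1 + int p * e \<noteq> 0"
    by (metis dvd_add_left_iff dvd_0_right dvd_triv_left)
  then have "lucas_u v p \<noteq> 0"
    using e p by simp
  then show "lucas_u a (n * p) \<noteq> 0"
    using nz by (simp add: lucas_u_mult v_def)
  have "int p ^ Suc r * int p dvd lucas_u a n * lucas_u v p"
    using dvd e by (intro mult_dvd_mono) auto
  then show "int p ^ Suc (Suc r) dvd lucas_u a (n * p)"
    by (simp add: lucas_u_mult v_def mult_ac)
qed

lemma lucas_u_prime_power:
  fixes p :: nat
  assumes p: "prime p" "p \<ge> 3" and nz: "lucas_u a n \<noteq> 0"
    and r: "r \<ge> 1" "int p ^ r dvd lucas_u a n"
  shows "lucas_u a (n * p ^ j) \<noteq> 0 \<and> int p ^ (r + j) dvd lucas_u a (n * p ^ j)"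
proof (induction j)
  case 0
  show ?case using nz r by simp
next
  case (Suc j)
  obtain r' where "r = Suc r'"
    using r by (cases r) auto
  then show ?case
    using lucas_u_prime_step[OF p, of a "n * p ^ j" "r' + j"] Suc by (simp add: mult_ac)
qed

text \<open>The second-order term dies modulo \<open>l^M\<close>, and the sum of squares depends
  only on \<open>m\<close> modulo \<open>U^2\<close>, so it may be frozen at
  \<open>m0\<close>.\<close>

lemma lucas_u_quotient_cong:
  fixes l :: nat
  assumes l: "prime l" "l \<ge> 3" and M: "M > 0" and dvd: "int l ^ M dvd U"
    and v: "v\<^sup>2 - 4 = d * U\<^sup>2" and m: "int m = int m0 + U\<^sup>2 * s"
  shows "\<exists>q. lucas_u v (2 * m + 1) = 2 * int m + 1 + U\<^sup>2 * q
           \<and> [q = d * (\<Sum>i\<le>m0. (int i)\<^sup>2)] (mod (int l ^ M))"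
proof -
  define A where "A m = (\<Sum>i\<le>m. (int i)\<^sup>2)" for m
  obtain b where b: "lucas_u v (2 * m + 1)
      = 2 * int m + 1 + (d * U\<^sup>2) * A m + (d * U\<^sup>2)\<^sup>2 * b"
    using lucas_u_odd_expansion[of v m] unfolding v A_def by blast
  have "[(2 * int m + 1) ^ 3 - (2 * int m + 1) = (2 * int m0 + 1) ^ 3 - (2 * int m0 + 1)] (mod U\<^sup>2)"
    unfolding m by (intro cong_diff cong_pow cong_add cong_mult cong_refl) (simp_all add: cong_def)
  then have "U\<^sup>2 dvd 24 * A m - 24 * A m0"
    unfolding A_def sum_squares_24 by (simp add: cong_iff_dvd_diff)
  \<comment> \<open>As \<open>M > 0\<close>, \<open>2*M\<close> is at least \<open>M + 1\<close>:
    the spare factor pays for cancelling 24 when \<open>l = 3\<close>.\<close>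
  moreover have "int l ^ Suc M dvd (int l ^ M)\<^sup>2"
    using M unfolding power_mult[symmetric] by (intro le_imp_power_dvd) simp
  ultimately have "int l ^ Suc M dvd 24 * (A m - A m0)"
    using dvd_power_same[OF dvd, of 2] unfolding right_diff_distrib by (meson dvd_trans)
  then have "[A m = A m0] (mod (int l ^ M))"
    using prime_power_dvd_of_dvd_24_mult[OF l] by (simp add: cong_iff_dvd_diff)
  then have "[d * A m + d\<^sup>2 * U\<^sup>2 * b = d * A m0 + 0] (mod (int l ^ M))"
    using dvd by (intro cong_add cong_mult cong_refl) (auto simp: cong_0_iff power2_eq_square)
  moreover have "lucas_u v (2 * m + 1) = 2 * int m + 1 + U\<^sup>2 * (d * A m + d\<^sup>2 * U\<^sup>2 * b)"
    unfolding b by (simp add: algebra_simps power2_eq_square)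
  ultimately show ?thesis
    unfolding A_def by auto
qed

section \<open>Construction of the indices\<close>

theorem corollary5p7:
  fixes a \<delta> t c :: int
    and l n0 r0 M j :: nat
    and u :: "nat \<Rightarrow> int"
    and N :: "nat \<Rightarrow> nat"
  assumes delta: "\<delta> = a\<^sup>2 - 4"
    and u: "u = lucas_u a"
    and l: "prime l" "l \<ge> 3" "\<not> int l dvd \<delta>"
    and n0: "n0 > 0" "u n0 \<noteq> 0"
    and r0: "r0 = multiplicity (int l) (u n0)" "r0 \<ge> 1"
    and N: "\<And>i. N i = n0 * l ^ i"
    and t: "odd t"
    and M: "M > 0"
    and j: "int j \<ge> max 0 (int M - int r0)"
  shows "infinite {k :: nat. k > 0 \<and> odd k \<and> [int k = t] (mod (u (N j))\<^sup>2) \<and>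
           rat_cong ((of_int (u (N j * k)) / of_int (u (N j)) - of_int t) / of_int ((u (N j))\<^sup>2))
             c (int l ^ M)}"
proof -
  define U where "U = u (N j)"
  define v where "v = lucas_v a (N j)"
  have "int l ^ r0 dvd lucas_u a n0"
    using r0(1) u multiplicity_dvd by metis
  then have U: "U \<noteq> 0" and "int l ^ (r0 + j) dvd U"
    using lucas_u_prime_power[OF l(1,2), of a n0 r0 j] n0(2) r0(2) unfolding U_def N u by auto
  \<comment> \<open>This is where the lower bound on \<open>j\<close> enters.\<close>
  moreover have "M \<le> r0 + j"
    using j by simp
  ultimately have lM: "int l ^ M dvd U"
    using power_le_dvd by blast
  have v: "v\<^sup>2 - 4 = \<delta> * U\<^sup>2"
    unfolding v_def U_def u delta by (rule lucas_v_square)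
  obtain t' where t': "t = 2 * t' + 1"
    using t by (elim oddE)
  \<comment> \<open>Adding \<open>\<bar>t\<bar> * U^2\<close> makes the starting index nonnegative
    even for negative \<open>t\<close>, without changing it modulo \<open>U^2\<close>.\<close>
  have "t \<noteq> 0" "U\<^sup>2 \<ge> 1"
    using t U by (auto simp: int_one_le_iff_zero_less)
  then have "\<bar>t\<bar> * 1 \<le> \<bar>t\<bar> * U\<^sup>2"
    by (intro mult_left_mono) auto
  then have "0 \<le> t' + \<bar>t\<bar> * U\<^sup>2"
    using t' by linarith
  then obtain m0 where m0: "int m0 = t' + \<bar>t\<bar> * U\<^sup>2"
    using nonneg_int_cases by metis
  define A where "A = (\<Sum>i\<le>m0. (int i)\<^sup>2)"
  have "coprime (2::int) (int l ^ M)"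
    using l(1,2) primes_coprime_nat[of 2 l] by (simp add: two_is_prime_nat flip: coprime_int_iff)
  then obtain y where y: "[2 * y = 1] (mod (int l ^ M))"
    using cong_solve_coprime_int by blast
  \<comment> \<open>\<open>s0\<close> solves \<open>2*\<bar>t\<bar> + 2*s0 + \<delta>*A = c\<close>
    modulo \<open>l^M\<close>, with \<open>y\<close> inverting 2; reducing it makes it
    nonnegative.\<close>
  define s0 where "s0 = y * (c - 2 * \<bar>t\<bar> - \<delta> * A) mod int l ^ M"
  have lpos: "int l ^ M > 0"
    using l(2) by simp
  have "s0 \<ge> 0"
    using lpos unfolding s0_def by simp
  have "[2 * s0 = 2 * (y * (c - 2 * \<bar>t\<bar> - \<delta> * A))] (mod (int l ^ M))"
    unfolding s0_def by (intro cong_mult cong_refl) (simp add: cong_def)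
  also have "2 * (y * (c - 2 * \<bar>t\<bar> - \<delta> * A)) = (2 * y) * (c - 2 * \<bar>t\<bar> - \<delta> * A)"
    by simp
  also have "[\<dots> = 1 * (c - 2 * \<bar>t\<bar> - \<delta> * A)] (mod (int l ^ M))"
    by (intro cong_mult y cong_refl)
  finally have s0: "[2 * s0 = c - 2 * \<bar>t\<bar> - \<delta> * A] (mod (int l ^ M))"
    by simp
  \<comment> \<open>Every lift of \<open>s0\<close> gives one index. Oddness is built into
    \<open>k i\<close>, which equals \<open>t + U^2 * (2*\<bar>t\<bar> + 2 * s i)\<close>.\<close>
  define s where "s i = s0 + int l ^ M * int i" for i
  define k where "k i = 2 * (m0 + nat (U\<^sup>2 * s i)) + 1" for i
  have "inj k"
  proof (rule injI)
    fix i i' assume "k i = k i'"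
    moreover have "U\<^sup>2 * s i \<ge> 0" for i
      using \<open>s0 \<ge> 0\<close> unfolding s_def by simp
    ultimately have "U\<^sup>2 * s i = U\<^sup>2 * s i'"
      unfolding k_def by (simp add: eq_nat_nat_iff)
    then show "i = i'"
      using U l(2) unfolding s_def by simp
  qed
  have "k i > 0 \<and> odd (k i) \<and> [int (k i) = t] (mod (u (N j))\<^sup>2) \<and>
      rat_cong ((of_int (u (N j * k i)) / of_int (u (N j)) - of_int t) / of_int ((u (N j))\<^sup>2))
        c (int l ^ M)" for i
  proof -
    define m where "m = m0 + nat (U\<^sup>2 * s i)"
    have m: "int m = int m0 + U\<^sup>2 * s i"
      using \<open>s0 \<ge> 0\<close> unfolding m_def s_def by simp
    have k: "k i = 2 * m + 1"
      unfolding k_def m_def ..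
    have kt: "2 * int m + 1 = t + U\<^sup>2 * (2 * \<bar>t\<bar> + 2 * s i)"
      unfolding m m0 t' by (simp add: algebra_simps)
    \<comment> \<open>The residue of \<open>q\<close> does not depend on \<open>i\<close>, since all
      the \<open>m\<close> agree with \<open>m0\<close> modulo \<open>U^2\<close>.\<close>
    obtain q where q: "lucas_u v (k i) = 2 * int m + 1 + U\<^sup>2 * q"
      and q': "[q = \<delta> * A] (mod (int l ^ M))"
      using lucas_u_quotient_cong[OF l(1,2) M lM v m] unfolding k A_def by blast
    have w: "lucas_u v (k i) = t + U\<^sup>2 * (2 * \<bar>t\<bar> + 2 * s i + q)"
      unfolding q kt by (simp add: algebra_simps)
    have "u (N j * k i) = U * lucas_u v (k i)"
      unfolding U_def v_def u by (rule lucas_u_mult)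
    then have "(of_int (u (N j * k i)) / of_int U - of_int t) / of_int (U\<^sup>2)
        = (of_int (2 * \<bar>t\<bar> + 2 * s i + q) :: rat)"
      using U by (simp add: w)
    moreover have "[2 * \<bar>t\<bar> + 2 * s i + q = c] (mod (int l ^ M))"
    proof -
      have "[2 * s i = 2 * s0] (mod (int l ^ M))"
        unfolding s_def by (intro cong_mult cong_refl) (simp add: cong_def)
      then have "[2 * s i = c - 2 * \<bar>t\<bar> - \<delta> * A] (mod (int l ^ M))"
        using s0 cong_trans by blast
      then have "[2 * \<bar>t\<bar> + 2 * s i + q = 2 * \<bar>t\<bar> + (c - 2 * \<bar>t\<bar> - \<delta> * A) + \<delta> * A] (mod (int l ^ M))"
        using q' by (intro cong_add cong_refl)
      then show ?thesis by simp
    qed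
    ultimately have "rat_cong ((of_int (u (N j * k i)) / of_int U - of_int t) / of_int (U\<^sup>2))
        c (int l ^ M)"
      unfolding rat_cong_def by blast
    moreover have "[int (k i) = t] (mod U\<^sup>2)"
      using kt unfolding k by (simp add: cong_def add.commute)
    moreover have "k i > 0" "odd (k i)"
      unfolding k by simp_all
    ultimately show ?thesis
      unfolding U_def by blast
  qed
  then have "range k \<subseteq> {k. k > 0 \<and> odd k \<and> [int k = t] (mod (u (N j))\<^sup>2) \<and>
      rat_cong ((of_int (u (N j * k)) / of_int (u (N j)) - of_int t) / of_int ((u (N j))\<^sup>2))
        c (int l ^ M)}"
    by blast
  then show ?thesis
    using range_inj_infinite[OF \<open>inj k\<close>] by (rule infinite_super)
qed

end
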